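(* In an augmented virtual double category let $J\colon A\nrightarrow A$ be a horizontal morphism and let $\psi\colon J\Rightarrow(A)$ and $\phi\colon(A)\Rightarrow J$ be horizontal cells. Consider the identities (A) $\mathrm{id}_A=\psi\circ\phi$ and (J) $\mathrm{id}_J=\phi\circ\psi$, and assume that at least one of them holds. The following conditions are equivalent: (a) $\psi$ is cartesian; (b) $\psi$ is weakly cocartesian; (c) both identities (A) and (J) hold; (d) $\phi$ is cartesian; (e) $\phi$ is weakly cocartesian. Consequently, any horizontal cell of the form $J\Rightarrow(A)$ or $(A)\Rightarrow J$, with $J\colon A\nrightarrow A$, is cartesian if and only if it is weakly cocartesian.
   Context: **Augmented virtual double categories.** An augmented virtual double category $\mathcal K$ consists of: a class of objects; a category $\mathcal K_{\mathrm v}$ with these objects, whose morphisms $f\colon A\to C$ are called vertical; a directed graph $\mathcal K_{\mathrm h}$ with these objects as vertices, whose edges $J\colon A\nrightarrow B$ are called horizontal morphisms; and a class of cells. Each cell $\phi$ has a horizontal source, which is a (possibly empty) path $\underline J=(J_1,\dots,J_n)\colon A_0\nrightarrow A_n$ of horizontal morphisms; a horizontal target, which is a path $\underline K\colon C\nrightarrow D$ of length $|\underline K|\le 1$; a vertical source $f\colon A_0\to C$; and a vertical target $g\colon A_n\to D$. We write $\phi\colon\underline J\Rightarrow\underline K$. The empty path at $A$ is written $(A)$ (so $\underline K=(C)$ forces $C=D$), and $\frown$ denotes concatenation of paths. For each $n\ge 1$, each path of cells $\phi_i\colon\underline J_i\Rightarrow\underline K_i$ ($1\le i\le n$) with vertical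 source $f_{i-1}$ and vertical target $f_i$, and each cell $\psi\colon\underline K_1\frown\dots\frown\underline K_n\Rightarrow\underline L$ with vertical source $h$ and target $k$, there is a vertical composite $\psi\circ(\phi_1,\dots,\phi_n)\colon\underline J_1\frown\dots\frown\underline J_n\Rightarrow\underline L$ with vertical source $h\circ f_0$ and target $k\circ f_n$. There are horizontal identity cells $\mathrm{id}_J\colon J\Rightarrow J$ (with identities as vertical source and target) and vertical identity cells $\mathrm{id}_f\colon (A)\Rightarrow(C)$ for $f\colon A\to C$ (with vertical source and target $f$), with $\mathrm{id}_h\circ(\mathrm{id}_f)=\mathrm{id}_{h\circ f}$; write $\mathrm{id}_A:=\mathrm{id}_{\mathrm{id}_A}$. Axioms, whenever they make sense (for associativity: whenever both sides make sense): $\chi\circ(\psi_1\circ(\phi_{11},\dots,\phi_{1m_1}),\dots,\psi_n\circ(\phi_{n1},\dots,\phi_{nm_n}))=(\chi\circ(\psi_1,\dots,\psi_n))\circ(\phi_{11},\dots,\phi_{nm_n})$; $\mathrm{id}_C\circ(\phi)=\phi$; $\mathrm{id}_K\circ(\phi)=\phi$; $\phi\circ(\mathrm{id}_A)=\phi$; $\phi\circ(\mathrm{id}_{J_1},\dots,\mathrm{id}_{J_n})=\phi$; and $\psi\circ(\phi_1,\dots,\phi_i,\mathrm{id}_{f_i},\phi_{i+1},\dots,\phi_n)=\psi\circ(\phi_1,\dots,\phi_n)$ for $0\le i\le n$. A cell is horizontal if its vertical source and target are identities. **Cartesian and weakly cocartesian cells.** A cell $\psi\colon\underline J\Rightarrow\underline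 K$ with $|\underline J|\le1$, $\underline J\colon A\nrightarrow B$, vertical source $f\colon A\to C$ and target $g\colon B\to D$, is cartesian if every cell $\chi\colon\underline H\Rightarrow\underline K$, with $\underline H\colon X_0\nrightarrow X_n$ and with vertical source $f\circ h$ and target $g\circ k$ (for any $h\colon X_0\to A$, $k\colon X_n\to B$), factors as $\chi=\psi\circ\phi$ for a unique $\phi\colon\underline H\Rightarrow\underline J$ with vertical source $h$ and target $k$. A cell $\phi\colon\underline H\Rightarrow\underline J$ with $\underline J\colon A\nrightarrow B$ of length $\le1$, vertical source $h\colon X_0\to A$ and target $k\colon X_n\to B$, is weakly cocartesian if every cell $\chi\colon\underline H\Rightarrow\underline K$ with vertical source $f\circ h$ and target $g\circ k$ (for any $f\colon A\to C$, $g\colon B\to D$ and $\underline K\colon C\nrightarrow D$ of length $\le1$) factors as $\chi=\psi\circ\phi$ for a unique $\psi\colon\underline J\Rightarrow\underline K$ with vertical source $f$ and target $g$. (The cartesian cell $\psi$ of the claim defines $J$ as the horizontal unit of $A$.) *)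

theory Defs
  imports Main
begin

text \<open>
  A path \<open>A\<^sub>0 \<rightarrow> \<dots> \<rightarrow> A\<^sub>n\<close> of horizontal morphisms is a pair of its initial vertex and its list of
  edges. The initial vertex is recorded so that the empty paths \<open>(A)\<close> at different objects are
  distinct.
\<close>

type_synonym ('o, 'h) path = "'o \<times> 'h list"

text \<open>
  The sets \<open>objects\<close>, \<open>verticals\<close>, \<open>horizontals\<close>, \<open>cells\<close> are carriers; the operations are relevant
  only on them. \<open>vcomp K g f\<close> is \<open>g \<circ> f\<close>, \<open>vcell_comp K \<psi> [\<phi>\<^sub>1, \<dots>, \<phi>\<^sub>n]\<close> is
  \<open>\<psi> \<circ> (\<phi>\<^sub>1, \<dots>, \<phi>\<^sub>n)\<close>, \<open>hid_cell K J\<close> is the cell \<open>id\<^sub>J\<close>, and \<open>vid_cell K f\<close> is the cell \<open>id\<^sub>f\<close>.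
\<close>

record ('o, 'v, 'h, 'c) avdc_data =
  objects :: "'o set"
  verticals :: "'v set"
  vdom :: "'v \<Rightarrow> 'o"
  vcod :: "'v \<Rightarrow> 'o"
  vid :: "'o \<Rightarrow> 'v"
  vcomp :: "'v \<Rightarrow> 'v \<Rightarrow> 'v"
  horizontals :: "'h set"
  hdom :: "'h \<Rightarrow> 'o"
  hcod :: "'h \<Rightarrow> 'o"
  cells :: "'c set"
  hsource :: "'c \<Rightarrow> ('o, 'h) path"
  htarget :: "'c \<Rightarrow> ('o, 'h) path"
  vsource :: "'c \<Rightarrow> 'v"
  vtarget :: "'c \<Rightarrow> 'v"
  vcell_comp :: "'c \<Rightarrow> 'c list \<Rightarrow> 'c"
  hid_cell :: "'h \<Rightarrow> 'c"
  vid_cell :: "'v \<Rightarrow> 'c"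

definition vhom :: "('o, 'v, 'h, 'c, 'z) avdc_data_scheme \<Rightarrow> 'o \<Rightarrow> 'o \<Rightarrow> 'v set" where
  "vhom K A C = {f \<in> verticals K. vdom K f = A \<and> vcod K f = C}"

definition hhom :: "('o, 'v, 'h, 'c, 'z) avdc_data_scheme \<Rightarrow> 'o \<Rightarrow> 'o \<Rightarrow> 'h set" where
  "hhom K A B = {J \<in> horizontals K. hdom K J = A \<and> hcod K J = B}"

primrec edge_path ::
    "('o, 'v, 'h, 'c, 'z) avdc_data_scheme \<Rightarrow> 'o \<Rightarrow> 'h list \<Rightarrow> 'o \<Rightarrow> bool" where
  "edge_path K A [] B \<longleftrightarrow> A \<in> objects K \<and> A = B"
| "edge_path K A (J # Js) B \<longleftrightarrow> J \<in> hhom K A (hcod K J) \<and> edge_path K (hcod K J) Js B"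

definition hpaths :: "('o, 'v, 'h, 'c, 'z) avdc_data_scheme \<Rightarrow> 'o \<Rightarrow> 'o \<Rightarrow> ('o, 'h) path set" where
  "hpaths K A B = {P. fst P = A \<and> edge_path K A (snd P) B}"

definition path_length :: "('o, 'h) path \<Rightarrow> nat" where
  "path_length P = length (snd P)"

definition empty_path :: "'o \<Rightarrow> ('o, 'h) path" where
  "empty_path A = (A, [])"

definition edge :: "('o, 'v, 'h, 'c, 'z) avdc_data_scheme \<Rightarrow> 'h \<Rightarrow> ('o, 'h) path" where
  "edge K J = (hdom K J, [J])"

text \<open>Concatenation of a nonempty list of paths whose endpoints match.\<close>

definition path_concat :: "('o, 'h) path list \<Rightarrow> ('o, 'h) path" where
  "path_concat Ps = (fst (hd Ps), concat (map snd Ps))"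

text \<open>\<open>cell_hom K P Q f g\<close>: the cells \<open>P \<Rightarrow> Q\<close> with vertical source \<open>f\<close> and vertical target \<open>g\<close>.\<close>

definition cell_hom ::
    "('o, 'v, 'h, 'c, 'z) avdc_data_scheme \<Rightarrow> ('o, 'h) path \<Rightarrow> ('o, 'h) path \<Rightarrow> 'v \<Rightarrow> 'v \<Rightarrow> 'c set"
  where
  "cell_hom K P Q f g =
    {\<phi> \<in> cells K. hsource K \<phi> = P \<and> htarget K \<phi> = Q \<and> vsource K \<phi> = f \<and> vtarget K \<phi> = g}"

definition cell_path :: "('o, 'v, 'h, 'c, 'z) avdc_data_scheme \<Rightarrow> 'c list \<Rightarrow> bool" where
  "cell_path K \<phi>s \<longleftrightarrow> \<phi>s \<noteq> [] \<and> set \<phi>s \<subseteq> cells K \<and>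
    (\<forall>i. Suc i < length \<phi>s \<longrightarrow> vtarget K (\<phi>s ! i) = vsource K (\<phi>s ! Suc i))"

text \<open>\<open>composable K \<psi> \<phi>s\<close>: the vertical composite \<open>\<psi> \<circ> (\<phi>\<^sub>1, \<dots>, \<phi>\<^sub>n)\<close> makes sense.\<close>

definition composable :: "('o, 'v, 'h, 'c, 'z) avdc_data_scheme \<Rightarrow> 'c \<Rightarrow> 'c list \<Rightarrow> bool" where
  "composable K \<psi> \<phi>s \<longleftrightarrow>
    \<psi> \<in> cells K \<and> cell_path K \<phi>s \<and> hsource K \<psi> = path_concat (map (htarget K) \<phi>s)"

text \<open>The vertical morphisms \<open>f\<^sub>0, \<dots>, f\<^sub>n\<close> bounding the cells of a path \<open>\<phi>\<^sub>1, \<dots>, \<phi>\<^sub>n\<close>.\<close>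

definition cell_boundary :: "('o, 'v, 'h, 'c, 'z) avdc_data_scheme \<Rightarrow> 'c list \<Rightarrow> nat \<Rightarrow> 'v" where
  "cell_boundary K \<phi>s i = (if i = 0 then vsource K (hd \<phi>s) else vtarget K (\<phi>s ! (i - 1)))"

locale augmented_virtual_double_category =
  fixes K :: "('o, 'v, 'h, 'c, 'z) avdc_data_scheme"
  assumes vertical_objects:
      "f \<in> verticals K \<Longrightarrow> vdom K f \<in> objects K \<and> vcod K f \<in> objects K"
    and vid_hom: "A \<in> objects K \<Longrightarrow> vid K A \<in> vhom K A A"
    and vcomp_hom: "f \<in> vhom K A B \<Longrightarrow> g \<in> vhom K B C \<Longrightarrow> vcomp K g f \<in> vhom K A C"
    and vcomp_vid_left: "f \<in> vhom K A B \<Longrightarrow> vcomp K (vid K B) f = f"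
    and vcomp_vid_right: "f \<in> vhom K A B \<Longrightarrow> vcomp K f (vid K A) = f"
    and vcomp_assoc:
      "f \<in> vhom K A B \<Longrightarrow> g \<in> vhom K B C \<Longrightarrow> h \<in> vhom K C D \<Longrightarrow>
        vcomp K h (vcomp K g f) = vcomp K (vcomp K h g) f"
    and horizontal_objects:
      "J \<in> horizontals K \<Longrightarrow> hdom K J \<in> objects K \<and> hcod K J \<in> objects K"
    and cell_boundaries:
      "\<phi> \<in> cells K \<Longrightarrow> \<exists>A B C D.
        hsource K \<phi> \<in> hpaths K A B \<and> htarget K \<phi> \<in> hpaths K C D \<and>
        path_length (htarget K \<phi>) \<le> 1 \<and>
        vsource K \<phi> \<in> vhom K A C \<and> vtarget K \<phi> \<in> vhom K B D"
    and vcell_comp_hom: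
      "composable K \<psi> \<phi>s \<Longrightarrow>
        vcell_comp K \<psi> \<phi>s \<in> cell_hom K (path_concat (map (hsource K) \<phi>s)) (htarget K \<psi>)
          (vcomp K (vsource K \<psi>) (vsource K (hd \<phi>s)))
          (vcomp K (vtarget K \<psi>) (vtarget K (last \<phi>s)))"
    and hid_cell_hom:
      "J \<in> hhom K A B \<Longrightarrow> hid_cell K J \<in> cell_hom K (edge K J) (edge K J) (vid K A) (vid K B)"
    and vid_cell_hom:
      "f \<in> vhom K A C \<Longrightarrow> vid_cell K f \<in> cell_hom K (empty_path A) (empty_path C) f f"
    and vid_cell_vcomp:
      "f \<in> vhom K A B \<Longrightarrow> h \<in> vhom K B C \<Longrightarrow>
        vcell_comp K (vid_cell K h) [vid_cell K f] = vid_cell K (vcomp K h f)"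
    and vcell_comp_assoc:
      "length \<psi>s = length \<phi>ss \<Longrightarrow>
       (\<And>i. i < length \<psi>s \<Longrightarrow> composable K (\<psi>s ! i) (\<phi>ss ! i)) \<Longrightarrow>
       composable K \<chi> (map2 (vcell_comp K) \<psi>s \<phi>ss) \<Longrightarrow>
       composable K \<chi> \<psi>s \<Longrightarrow>
       composable K (vcell_comp K \<chi> \<psi>s) (concat \<phi>ss) \<Longrightarrow>
        vcell_comp K \<chi> (map2 (vcell_comp K) \<psi>s \<phi>ss) =
        vcell_comp K (vcell_comp K \<chi> \<psi>s) (concat \<phi>ss)"
    and vid_cell_comp_left:
      "\<phi> \<in> cells K \<Longrightarrow> htarget K \<phi> = empty_path C \<Longrightarrow>
        vcell_comp K (vid_cell K (vid K C)) [\<phi>] = \<phi>"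
    and hid_cell_comp_left:
      "\<phi> \<in> cells K \<Longrightarrow> htarget K \<phi> = edge K J \<Longrightarrow> vcell_comp K (hid_cell K J) [\<phi>] = \<phi>"
    and vid_cell_comp_right:
      "\<phi> \<in> cells K \<Longrightarrow> hsource K \<phi> = empty_path A \<Longrightarrow>
        vcell_comp K \<phi> [vid_cell K (vid K A)] = \<phi>"
    and hid_cell_comp_right:
      "\<phi> \<in> cells K \<Longrightarrow> hsource K \<phi> = (A, Js) \<Longrightarrow> Js \<noteq> [] \<Longrightarrow>
        vcell_comp K \<phi> (map (hid_cell K) Js) = \<phi>"
    and vid_cell_insert:
      "composable K \<psi> \<phi>s \<Longrightarrow> i \<le> length \<phi>s \<Longrightarrow>
        vcell_comp K \<psi> (take i \<phi>s @ [vid_cell K (cell_boundary K \<phi>s i)] @ drop i \<phi>s) =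
        vcell_comp K \<psi> \<phi>s"

definition horizontal_cell :: "('o, 'v, 'h, 'c, 'z) avdc_data_scheme \<Rightarrow> 'c \<Rightarrow> bool" where
  "horizontal_cell K \<phi> \<longleftrightarrow> \<phi> \<in> cells K \<and>
    (\<exists>A \<in> objects K. vsource K \<phi> = vid K A) \<and> (\<exists>B \<in> objects K. vtarget K \<phi> = vid K B)"

definition cartesian :: "('o, 'v, 'h, 'c, 'z) avdc_data_scheme \<Rightarrow> 'c \<Rightarrow> bool" where
  "cartesian K \<psi> \<longleftrightarrow> \<psi> \<in> cells K \<and> path_length (hsource K \<psi>) \<le> 1 \<and>
    (\<forall>X Y H h k \<chi>.
      H \<in> hpaths K X Y \<and>
      h \<in> vhom K X (vdom K (vsource K \<psi>)) \<and> k \<in> vhom K Y (vdom K (vtarget K \<psi>)) \<and>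
      \<chi> \<in> cell_hom K H (htarget K \<psi>) (vcomp K (vsource K \<psi>) h) (vcomp K (vtarget K \<psi>) k) \<longrightarrow>
      (\<exists>!\<phi>. \<phi> \<in> cell_hom K H (hsource K \<psi>) h k \<and> \<chi> = vcell_comp K \<psi> [\<phi>]))"

definition weakly_cocartesian :: "('o, 'v, 'h, 'c, 'z) avdc_data_scheme \<Rightarrow> 'c \<Rightarrow> bool" where
  "weakly_cocartesian K \<phi> \<longleftrightarrow> \<phi> \<in> cells K \<and>
    (\<forall>C D L f g \<chi>.
      L \<in> hpaths K C D \<and> path_length L \<le> 1 \<and>
      f \<in> vhom K (vcod K (vsource K \<phi>)) C \<and> g \<in> vhom K (vcod K (vtarget K \<phi>)) D \<and>
      \<chi> \<in> cell_hom K (hsource K \<phi>) L (vcomp K f (vsource K \<phi>)) (vcomp K g (vtarget K \<phi>)) \<longrightarrow>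
      (\<exists>!\<psi>. \<psi> \<in> cell_hom K (htarget K \<phi>) L f g \<and> \<chi> = vcell_comp K \<psi> [\<phi>]))"

end

theory Submission
  imports Defs
begin

text \<open>
  For horizontal cells between paths of length at most one, being cartesian and being weakly
  cocartesian are both equivalent to being invertible under vertical composition: the inverse is
  the factorisation of an identity cell through the given one, and uniqueness of factorisations
  turns this one-sided inverse into a two-sided one. A one-sided inverse of an invertible cell is
  its inverse, so either of the identities (A) and (J) implies the other once one of the cells
  is invertible.
\<close>

text \<open>Intended for paths of length at most one. It merges the two sorts of identity cell into
  one, so that cells \<open>J \<Rightarrow> (A)\<close> and \<open>(A) \<Rightarrow> J\<close>
  become instances of a single argument about a cell \<open>P \<Rightarrow> Q\<close>.\<close>

definition path_id :: "('o, 'v, 'h, 'c, 'z) avdc_data_scheme \<Rightarrow> ('o, 'h) path \<Rightarrow> 'c" where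
  "path_id K P = (case snd P of [] \<Rightarrow> vid_cell K (vid K (fst P)) | J # _ \<Rightarrow> hid_cell K J)"

lemma path_id_empty_path [simp]: "path_id K (empty_path A) = vid_cell K (vid K A)"
  by (simp add: path_id_def empty_path_def)

lemma path_id_edge [simp]: "path_id K (edge K J) = hid_cell K J"
  by (simp add: path_id_def edge_def)

lemma short_path_cases:
  assumes "P \<in> hpaths K A B" "path_length P \<le> 1"
  obtains "P = empty_path A" "A = B" "A \<in> objects K"
    | J where "P = edge K J" "J \<in> hhom K A B"
proof (cases "snd P")
  case Nil
  then show ?thesis
    using assms that(1) by (cases P) (auto simp: hpaths_def empty_path_def)
next
  case (Cons J Js)
  then have "P = edge K J" "J \<in> hhom K A B"
    using assms by (cases P; auto simp: hpaths_def edge_def path_length_def hhom_def)+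
  then show ?thesis by (rule that(2))
qed

lemma empty_path_hpaths: "A \<in> objects K \<Longrightarrow> empty_path A \<in> hpaths K A A"
  by (simp add: hpaths_def empty_path_def)

lemma path_length_empty_path [simp]: "path_length (empty_path A) = 0"
  by (simp add: path_length_def empty_path_def)

lemma path_length_edge [simp]: "path_length (edge K J) = 1"
  by (simp add: path_length_def edge_def)

definition horizontal_hom ::
    "('o, 'v, 'h, 'c, 'z) avdc_data_scheme \<Rightarrow> 'o \<Rightarrow> 'o \<Rightarrow>
      ('o, 'h) path \<Rightarrow> ('o, 'h) path \<Rightarrow> 'c set" where
  "horizontal_hom K A B P Q = cell_hom K P Q (vid K A) (vid K B)"

text \<open>Both identities are taken at horizontal sources, which makes the relation visibly
  symmetric. For cells \<open>\<psi> : P \<Rightarrow> Q\<close> and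
  \<open>\<phi> : Q \<Rightarrow> P\<close> they are the identities of \<open>Q\<close> and of
  \<open>P\<close>.\<close>

definition inverse_cells ::
    "('o, 'v, 'h, 'c, 'z) avdc_data_scheme \<Rightarrow> 'c \<Rightarrow> 'c \<Rightarrow> bool" where
  "inverse_cells K \<psi> \<phi> \<longleftrightarrow>
    path_id K (hsource K \<phi>) = vcell_comp K \<psi> [\<phi>] \<and>
    path_id K (hsource K \<psi>) = vcell_comp K \<phi> [\<psi>]"

lemma inverse_cells_commute: "inverse_cells K \<psi> \<phi> \<longleftrightarrow> inverse_cells K \<phi> \<psi>"
  by (auto simp: inverse_cells_def)

section \<open>Category laws for composites with a single cell\<close>

context augmented_virtual_double_category
begin

abbreviation comp (infixr \<open>\<odot>\<close> 70) where "\<psi> \<odot> \<phi> \<equiv> vcell_comp K \<psi> [\<phi>]"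

lemma hpaths_objects:
  assumes "P \<in> hpaths K A B"
  shows "A \<in> objects K" "B \<in> objects K"
proof -
  have "edge_path K A Js B \<Longrightarrow> A \<in> objects K \<and> B \<in> objects K" for Js
    by (induction Js arbitrary: A) (auto simp: hhom_def dest: horizontal_objects)
  then show "A \<in> objects K" "B \<in> objects K"
    using assms by (auto simp: hpaths_def)
qed

lemma edge_hpaths: "J \<in> hhom K A B \<Longrightarrow> edge K J \<in> hpaths K A B"
  by (auto simp: hpaths_def edge_def hhom_def dest: horizontal_objects)

lemma path_id_hom:
  assumes "P \<in> hpaths K A B" "path_length P \<le> 1"
  shows "path_id K P \<in> horizontal_hom K A B P P"
  using assms
  by (cases rule: short_path_cases)
    (auto simp: horizontal_hom_def intro: vid_cell_hom vid_hom hid_cell_hom)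

text \<open>A path consisting of one cell has no inner vertical boundaries to match, so agreement of
  the horizontal paths at \<open>Q\<close> suffices.\<close>

lemma composable_singleton:
  assumes "\<phi> \<in> cell_hom K P Q f g" "\<psi> \<in> cell_hom K Q R h k"
  shows "composable K \<psi> [\<phi>]"
  using assms by (auto simp: composable_def cell_path_def cell_hom_def path_concat_def)

lemma comp_hom:
  assumes "\<phi> \<in> cell_hom K P Q f g" "\<psi> \<in> cell_hom K Q R h k"
  shows "\<psi> \<odot> \<phi> \<in> cell_hom K P R (vcomp K h f) (vcomp K k g)"
  using vcell_comp_hom[OF composable_singleton[OF assms]] assms
  by (auto simp: cell_hom_def path_concat_def)

lemma comp_assoc:
  assumes "\<phi> \<in> cell_hom K P Q f g" "\<psi> \<in> cell_hom K Q R h k" "\<chi> \<in> cell_hom K R S l m"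
  shows "\<chi> \<odot> \<psi> \<odot> \<phi> = (\<chi> \<odot> \<psi>) \<odot> \<phi>"
  using vcell_comp_assoc[of "[\<psi>]" "[[\<phi>]]" \<chi>] assms
  by (simp add: composable_singleton[OF assms(1,2)] composable_singleton[OF assms(2,3)]
      composable_singleton[OF comp_hom[OF assms(1,2)] assms(3)]
      composable_singleton[OF assms(1) comp_hom[OF assms(2,3)]])

lemma path_id_left:
  assumes "\<phi> \<in> cell_hom K P Q f g" "Q \<in> hpaths K C D" "path_length Q \<le> 1"
  shows "path_id K Q \<odot> \<phi> = \<phi>"
  using assms(2,3)
proof (cases rule: short_path_cases)
  case 1
  then show ?thesis using assms(1) by (simp add: cell_hom_def vid_cell_comp_left)
next
  case (2 J)
  then show ?thesis using assms(1) by (simp add: cell_hom_def hid_cell_comp_left)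
qed

lemma path_id_right:
  assumes "\<phi> \<in> cell_hom K P Q f g" "P \<in> hpaths K A B" "path_length P \<le> 1"
  shows "\<phi> \<odot> path_id K P = \<phi>"
  using assms(2,3)
proof (cases rule: short_path_cases)
  case 1
  then show ?thesis using assms(1) by (simp add: cell_hom_def vid_cell_comp_right)
next
  case (2 J)
  then show ?thesis
    using assms(1) hid_cell_comp_right[of \<phi> "hdom K J" "[J]"]
    by (simp add: cell_hom_def edge_def path_id_def)
qed

text \<open>The axiom \<open>cell_boundaries\<close> only provides some endpoints. A path determines
  them: its initial vertex is recorded, and its final vertex is unique by induction on the
  edges.\<close>

lemma cell_hom_verticals:
  assumes "\<chi> \<in> cell_hom K P Q f g" "P \<in> hpaths K A B" "Q \<in> hpaths K C D"
  shows "f \<in> vhom K A C" "g \<in> vhom K B D"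
proof -
  have end_unique: "edge_path K X Js Y \<Longrightarrow> edge_path K X Js Z \<Longrightarrow> Y = Z" for X Y Z Js
    by (induction Js arbitrary: X) auto
  obtain A' B' C' D' where ends: "P \<in> hpaths K A' B'" "Q \<in> hpaths K C' D'"
    and "f \<in> vhom K A' C'" "g \<in> vhom K B' D'"
    using cell_boundaries[of \<chi>] assms(1) by (auto simp: cell_hom_def)
  moreover have "A' = A" "C' = C"
    using assms(2,3) ends by (auto simp: hpaths_def)
  moreover have "B' = B" "D' = D"
    using assms(2,3) ends end_unique unfolding hpaths_def by blast+
  ultimately show "f \<in> vhom K A C" "g \<in> vhom K B D" by simp_all
qed

text \<open>A horizontal cell has identities of unspecified objects as its vertical boundaries.
  Their domains must be the endpoints of the horizontal source, which identifies those objects as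
  \<open>A\<close> and \<open>B\<close>.\<close>

lemma horizontal_cellD:
  assumes "horizontal_cell K \<phi>" "hsource K \<phi> \<in> hpaths K A B" "htarget K \<phi> \<in> hpaths K A B"
  shows "\<phi> \<in> horizontal_hom K A B (hsource K \<phi>) (htarget K \<phi>)"
proof -
  have \<phi>: "\<phi> \<in> cell_hom K (hsource K \<phi>) (htarget K \<phi>) (vsource K \<phi>) (vtarget K \<phi>)"
    using assms(1) by (simp add: cell_hom_def horizontal_cell_def)
  have "vsource K \<phi> = vid K A" "vtarget K \<phi> = vid K B"
    using assms(1) cell_hom_verticals[OF \<phi> assms(2,3)] vid_hom
    by (auto simp: horizontal_cell_def vhom_def)
  then show ?thesis using \<phi> by (simp add: horizontal_hom_def)
qed

section \<open>Universal properties and invertibility of a horizontal cell between parallel short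
  paths\<close>

context
  fixes A B :: 'o and P Q :: "('o, 'h) path" and \<psi> :: 'c
  assumes P: "P \<in> hpaths K A B" "path_length P \<le> 1"
    and Q: "Q \<in> hpaths K A B" "path_length Q \<le> 1"
    and \<psi>: "\<psi> \<in> horizontal_hom K A B P Q"
begin

lemma vid_endpoints: "vid K A \<in> vhom K A A" "vid K B \<in> vhom K B B"
  using hpaths_objects[OF P(1)] by (auto intro: vid_hom)

lemma vid_comp_vid: "vcomp K (vid K A) (vid K A) = vid K A" "vcomp K (vid K B) (vid K B) = vid K B"
  using vid_endpoints by (auto intro: vcomp_vid_left)

lemma \<psi>_hom: "\<psi> \<in> cell_hom K P Q (vid K A) (vid K B)"
  using \<psi> by (simp add: horizontal_hom_def)

lemma \<psi>_simps:
  "hsource K \<psi> = P" "htarget K \<psi> = Q" "vsource K \<psi> = vid K A" "vtarget K \<psi> = vid K B"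
  "\<psi> \<in> cells K"
  using \<psi>_hom by (auto simp: cell_hom_def)

lemma vid_dom_cod: "vdom K (vid K A) = A" "vcod K (vid K A) = A"
  "vdom K (vid K B) = B" "vcod K (vid K B) = B"
  using vid_endpoints by (auto simp: vhom_def)

lemma inverse_cells_horizontal:
  assumes "\<phi> \<in> horizontal_hom K A B Q P"
  shows "inverse_cells K \<psi> \<phi> \<longleftrightarrow> path_id K Q = \<psi> \<odot> \<phi> \<and> path_id K P = \<phi> \<odot> \<psi>"
  using assms \<psi>_hom by (auto simp: inverse_cells_def horizontal_hom_def cell_hom_def)

text \<open>The factorisation of \<open>\<chi>\<close> is \<open>\<phi> \<odot> \<chi>\<close>: it
  exists because \<open>\<psi> \<odot> \<phi>\<close> is an identity, and it is unique because
  \<open>\<phi> \<odot> \<psi>\<close> is one.\<close>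

lemma inverse_imp_cartesian:
  assumes \<phi>: "\<phi> \<in> horizontal_hom K A B Q P" and inv: "inverse_cells K \<psi> \<phi>"
  shows "cartesian K \<psi>"
proof -
  note \<phi>' = \<phi>[unfolded horizontal_hom_def]
  have inv': "path_id K Q = \<psi> \<odot> \<phi>" "path_id K P = \<phi> \<odot> \<psi>"
    using inv inverse_cells_horizontal[OF \<phi>] by auto
  have "\<exists>!\<theta>. \<theta> \<in> cell_hom K H P h k \<and> \<chi> = \<psi> \<odot> \<theta>"
    if h: "h \<in> vhom K X A" and k: "k \<in> vhom K Y B"
      and "\<chi> \<in> cell_hom K H Q (vcomp K (vid K A) h) (vcomp K (vid K B) k)" for X Y H h k \<chi>
  proof (rule ex1I[of _ "\<phi> \<odot> \<chi>"])
    have \<chi>: "\<chi> \<in> cell_hom K H Q h k"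
      using that by (simp add: vcomp_vid_left[OF h] vcomp_vid_left[OF k])
    show "\<phi> \<odot> \<chi> \<in> cell_hom K H P h k \<and> \<chi> = \<psi> \<odot> \<phi> \<odot> \<chi>"
      using comp_hom[OF \<chi> \<phi>'] comp_assoc[OF \<chi> \<phi>' \<psi>_hom] path_id_left[OF \<chi> Q]
      by (simp add: vcomp_vid_left[OF h] vcomp_vid_left[OF k] flip: inv')
    show "\<theta> = \<phi> \<odot> \<chi>" if "\<theta> \<in> cell_hom K H P h k \<and> \<chi> = \<psi> \<odot> \<theta>" for \<theta>
      using that comp_assoc[of \<theta> H P h k, OF _ \<psi>_hom \<phi>'] path_id_left[of \<theta> H P h k, OF _ P]
      by (simp flip: inv')
  qed
  then show ?thesis
    using P(2) \<psi>_simps(5) unfolding cartesian_def \<psi>_simps(1-4) vid_dom_cod by blast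
qed

text \<open>Dually, the factorisation is \<open>\<chi> \<odot> \<phi>\<close>. Here
  \<open>\<phi> \<odot> \<psi>\<close> being an identity gives existence, and
  \<open>\<psi> \<odot> \<phi>\<close> being one gives uniqueness.\<close>

lemma inverse_imp_weakly_cocartesian:
  assumes \<phi>: "\<phi> \<in> horizontal_hom K A B Q P" and inv: "inverse_cells K \<psi> \<phi>"
  shows "weakly_cocartesian K \<psi>"
proof -
  note \<phi>' = \<phi>[unfolded horizontal_hom_def]
  have inv': "path_id K Q = \<psi> \<odot> \<phi>" "path_id K P = \<phi> \<odot> \<psi>"
    using inv inverse_cells_horizontal[OF \<phi>] by auto
  have "\<exists>!\<theta>. \<theta> \<in> cell_hom K Q L f g \<and> \<chi> = \<theta> \<odot> \<psi>"
    if f: "f \<in> vhom K A C" and g: "g \<in> vhom K B D"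
      and "\<chi> \<in> cell_hom K P L (vcomp K f (vid K A)) (vcomp K g (vid K B))" for C D L f g \<chi>
  proof (rule ex1I[of _ "\<chi> \<odot> \<phi>"])
    have \<chi>: "\<chi> \<in> cell_hom K P L f g"
      using that by (simp add: vcomp_vid_right[OF f] vcomp_vid_right[OF g])
    show "\<chi> \<odot> \<phi> \<in> cell_hom K Q L f g \<and> \<chi> = (\<chi> \<odot> \<phi>) \<odot> \<psi>"
      using comp_hom[OF \<phi>' \<chi>] comp_assoc[OF \<psi>_hom \<phi>' \<chi>] path_id_right[OF \<chi> P]
      by (simp add: vcomp_vid_right[OF f] vcomp_vid_right[OF g] flip: inv')
    show "\<theta> = \<chi> \<odot> \<phi>" if "\<theta> \<in> cell_hom K Q L f g \<and> \<chi> = \<theta> \<odot> \<psi>" for \<theta>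
      using that comp_assoc[OF \<phi>' \<psi>_hom, of \<theta> L f g] path_id_right[of \<theta> Q L f g, OF _ Q]
      by (simp flip: inv')
  qed
  then show ?thesis
    using \<psi>_simps(5) unfolding weakly_cocartesian_def \<psi>_simps(1-4) vid_dom_cod by blast
qed

lemma cartesian_imp_inverse:
  assumes "cartesian K \<psi>"
  obtains \<phi> where "\<phi> \<in> horizontal_hom K A B Q P" "inverse_cells K \<psi> \<phi>"
proof -
  note idP = path_id_hom[OF P, unfolded horizontal_hom_def]
    and idQ = path_id_hom[OF Q, unfolded horizontal_hom_def]
  \<comment> \<open>The universal property restricted to identity vertical morphisms; the composites
    of identities in its definition collapse.\<close>
  have factor: "\<exists>!\<phi>. \<phi> \<in> cell_hom K H P (vid K A) (vid K B) \<and> \<chi> = \<psi> \<odot> \<phi>"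
    if "H \<in> hpaths K A B" "\<chi> \<in> cell_hom K H Q (vid K A) (vid K B)" for H \<chi>
  proof -
    have "\<chi> \<in> cell_hom K H Q (vcomp K (vid K A) (vid K A)) (vcomp K (vid K B) (vid K B))"
      using that by (simp add: vid_comp_vid)
    then show ?thesis
      using assms that(1) vid_endpoints
      unfolding cartesian_def \<psi>_simps(1-4) vid_dom_cod by blast
  qed
  obtain \<phi> where \<phi>: "\<phi> \<in> cell_hom K Q P (vid K A) (vid K B)" "path_id K Q = \<psi> \<odot> \<phi>"
    using factor[OF Q(1) idQ] by blast
  \<comment> \<open>\<open>\<phi>\<close> is so far only a right inverse. Both
    \<open>\<phi> \<odot> \<psi>\<close> and the identity of \<open>P\<close> factor
    \<open>\<psi>\<close> through itself, so uniqueness makes them equal.\<close>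
  have "\<psi> = \<psi> \<odot> \<phi> \<odot> \<psi>"
    using comp_assoc[OF \<psi>_hom \<phi>(1) \<psi>_hom] path_id_left[OF \<psi>_hom Q] by (simp flip: \<phi>(2))
  moreover have "\<psi> = \<psi> \<odot> path_id K P"
    using path_id_right[OF \<psi>_hom P] by simp
  moreover have "\<phi> \<odot> \<psi> \<in> cell_hom K P P (vid K A) (vid K B)"
    using comp_hom[OF \<psi>_hom \<phi>(1)] by (simp add: vid_comp_vid)
  ultimately have "path_id K P = \<phi> \<odot> \<psi>"
    using factor[OF P(1) \<psi>_hom] idP by blast
  then show ?thesis
    using that \<phi> by (simp add: inverse_cells_horizontal horizontal_hom_def)
qed

text \<open>Factoring the identity of \<open>P\<close> gives a left inverse \<open>\<phi>\<close>.
  Then \<open>\<psi> \<odot> \<phi>\<close> and the identity of \<open>Q\<close> both solve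
  \<open>\<psi> = \<theta> \<odot> \<psi>\<close> for \<open>\<theta>\<close>. The property is
  tested only on the targets \<open>P\<close> and \<open>Q\<close>, which are short enough to be
  allowed.\<close>

lemma weakly_cocartesian_imp_inverse:
  assumes "weakly_cocartesian K \<psi>"
  obtains \<phi> where "\<phi> \<in> horizontal_hom K A B Q P" "inverse_cells K \<psi> \<phi>"
proof -
  note idP = path_id_hom[OF P, unfolded horizontal_hom_def]
    and idQ = path_id_hom[OF Q, unfolded horizontal_hom_def]
  have factor: "\<exists>!\<phi>. \<phi> \<in> cell_hom K Q L (vid K A) (vid K B) \<and> \<chi> = \<phi> \<odot> \<psi>"
    if "L \<in> hpaths K A B" "path_length L \<le> 1" "\<chi> \<in> cell_hom K P L (vid K A) (vid K B)" for L \<chi>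
  proof -
    have "\<chi> \<in> cell_hom K P L (vcomp K (vid K A) (vid K A)) (vcomp K (vid K B) (vid K B))"
      using that by (simp add: vid_comp_vid)
    then show ?thesis
      using assms that(1,2) vid_endpoints
      unfolding weakly_cocartesian_def \<psi>_simps(1-4) vid_dom_cod by blast
  qed
  obtain \<phi> where \<phi>: "\<phi> \<in> cell_hom K Q P (vid K A) (vid K B)" "path_id K P = \<phi> \<odot> \<psi>"
    using factor[OF P idP] by blast
  have "\<psi> = (\<psi> \<odot> \<phi>) \<odot> \<psi>"
    using comp_assoc[OF \<psi>_hom \<phi>(1) \<psi>_hom] path_id_right[OF \<psi>_hom P] by (simp flip: \<phi>(2))
  moreover have "\<psi> = path_id K Q \<odot> \<psi>"
    using path_id_left[OF \<psi>_hom Q] by simp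
  moreover have "\<psi> \<odot> \<phi> \<in> cell_hom K Q Q (vid K A) (vid K B)"
    using comp_hom[OF \<phi>(1) \<psi>_hom] by (simp add: vid_comp_vid)
  ultimately have "path_id K Q = \<psi> \<odot> \<phi>"
    using factor[OF Q \<psi>_hom] idQ by blast
  then show ?thesis
    using that \<phi> by (simp add: inverse_cells_horizontal horizontal_hom_def)
qed

lemma cartesian_iff_weakly_cocartesian: "cartesian K \<psi> \<longleftrightarrow> weakly_cocartesian K \<psi>"
  using cartesian_imp_inverse weakly_cocartesian_imp_inverse
    inverse_imp_cartesian inverse_imp_weakly_cocartesian by metis

text \<open>The usual uniqueness of inverses: a right inverse \<open>\<phi>\<close> satisfies
  \<open>\<theta> = \<theta> \<odot> (\<psi> \<odot> \<phi>) = (\<theta> \<odot> \<psi>) \<odot>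
  \<phi> = \<phi>\<close>, and a left inverse is treated with \<open>\<phi>\<close> and
  \<open>\<theta>\<close> exchanged.\<close>

lemma one_sided_inverse_of_invertible:
  assumes \<phi>: "\<phi> \<in> horizontal_hom K A B Q P"
    and one_sided: "path_id K Q = \<psi> \<odot> \<phi> \<or> path_id K P = \<phi> \<odot> \<psi>"
    and \<theta>: "\<theta> \<in> horizontal_hom K A B Q P" and inv: "inverse_cells K \<psi> \<theta>"
  shows "inverse_cells K \<psi> \<phi>"
proof -
  note \<phi>' = \<phi>[unfolded horizontal_hom_def] and \<theta>' = \<theta>[unfolded horizontal_hom_def]
  have inv': "path_id K Q = \<psi> \<odot> \<theta>" "path_id K P = \<theta> \<odot> \<psi>"
    using inv inverse_cells_horizontal[OF \<theta>] by auto
  from one_sided have "\<phi> = \<theta>"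
  proof
    assume "path_id K Q = \<psi> \<odot> \<phi>"
    then have "\<theta> \<odot> path_id K Q = path_id K P \<odot> \<phi>"
      using comp_assoc[OF \<phi>' \<psi>_hom \<theta>'] inv'(2) by simp
    then show ?thesis
      using path_id_right[OF \<theta>' Q] path_id_left[OF \<phi>' P] by simp
  next
    assume "path_id K P = \<phi> \<odot> \<psi>"
    then have "\<phi> \<odot> path_id K Q = path_id K P \<odot> \<theta>"
      using comp_assoc[OF \<theta>' \<psi>_hom \<phi>'] inv'(1) by simp
    then show ?thesis
      using path_id_right[OF \<phi>' Q] path_id_left[OF \<theta>' P] by simp
  qed
  with inv show ?thesis by simp
qed

text \<open>Cartesianness yields some inverse; the one-sided identity is what forces the given
  \<open>\<phi>\<close> to be that inverse.\<close>

lemma cartesian_iff_inverse: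
  assumes "\<phi> \<in> horizontal_hom K A B Q P"
    and "path_id K Q = \<psi> \<odot> \<phi> \<or> path_id K P = \<phi> \<odot> \<psi>"
  shows "cartesian K \<psi> \<longleftrightarrow> inverse_cells K \<psi> \<phi>"
  using cartesian_imp_inverse inverse_imp_cartesian one_sided_inverse_of_invertible assms by metis

end

end

theorem lemma5p9:
  fixes K :: "('o, 'v, 'h, 'c, 'z) avdc_data_scheme"
  assumes "augmented_virtual_double_category K"
  shows
    "(\<forall>A J \<psi> \<phi>.
        J \<in> hhom K A A \<and>
        horizontal_cell K \<psi> \<and> hsource K \<psi> = edge K J \<and> htarget K \<psi> = empty_path A \<and>
        horizontal_cell K \<phi> \<and> hsource K \<phi> = empty_path A \<and> htarget K \<phi> = edge K J \<and>
        (vid_cell K (vid K A) = vcell_comp K \<psi> [\<phi>] \<or> hid_cell K J = vcell_comp K \<phi> [\<psi>]) \<longrightarrow>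
          (cartesian K \<psi> \<longleftrightarrow> weakly_cocartesian K \<psi>) \<and>
          (weakly_cocartesian K \<psi> \<longleftrightarrow>
            vid_cell K (vid K A) = vcell_comp K \<psi> [\<phi>] \<and> hid_cell K J = vcell_comp K \<phi> [\<psi>]) \<and>
          (vid_cell K (vid K A) = vcell_comp K \<psi> [\<phi>] \<and> hid_cell K J = vcell_comp K \<phi> [\<psi>]
            \<longleftrightarrow> cartesian K \<phi>) \<and>
          (cartesian K \<phi> \<longleftrightarrow> weakly_cocartesian K \<phi>)) \<and>
     (\<forall>A J \<chi>.
        J \<in> hhom K A A \<and> horizontal_cell K \<chi> \<and>
        (hsource K \<chi> = edge K J \<and> htarget K \<chi> = empty_path A \<or>
         hsource K \<chi> = empty_path A \<and> htarget K \<chi> = edge K J) \<longrightarrow>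
          (cartesian K \<chi> \<longleftrightarrow> weakly_cocartesian K \<chi>))"
proof -
  interpret augmented_virtual_double_category K by fact
  show ?thesis
  \<comment> \<open>The pattern given to \<open>conjI\<close> splits only the outer conjunction,
    leaving the chain of equivalences as one goal.\<close>
  proof (intro conjI[of "\<forall>A J \<psi> \<phi>. _ A J \<psi> \<phi>"] allI impI, goal_cases)
    case (1 A J \<psi> \<phi>)
    then have J: "J \<in> hhom K A A" by simp
    then have A: "A \<in> objects K" using hpaths_objects edge_hpaths by blast
    note P = edge_hpaths[OF J] and Q = empty_path_hpaths[OF A]
    have \<psi>: "\<psi> \<in> horizontal_hom K A A (edge K J) (empty_path A)"
      using horizontal_cellD[of \<psi> A A] 1 P Q by simp
    have \<phi>: "\<phi> \<in> horizontal_hom K A A (empty_path A) (edge K J)"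
      using horizontal_cellD[of \<phi> A A] 1 P Q by simp
    have "cartesian K \<psi> \<longleftrightarrow> inverse_cells K \<psi> \<phi>"
      using cartesian_iff_inverse[OF P _ Q _ \<psi> \<phi>] 1 by simp
    \<comment> \<open>The same lemma with the two paths and the two cells exchanged: the hypothesis
      "(A) or (J)" and the relation \<open>inverse_cells\<close> are both symmetric under this
      exchange.\<close>
    moreover have "cartesian K \<phi> \<longleftrightarrow> inverse_cells K \<psi> \<phi>"
      using cartesian_iff_inverse[OF Q _ P _ \<phi> \<psi>] 1 inverse_cells_commute[of K \<psi> \<phi>] by auto
    moreover have "cartesian K \<psi> \<longleftrightarrow> weakly_cocartesian K \<psi>"
      "cartesian K \<phi> \<longleftrightarrow> weakly_cocartesian K \<phi>"
      using cartesian_iff_weakly_cocartesian[OF P _ Q _ \<psi>]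
        cartesian_iff_weakly_cocartesian[OF Q _ P _ \<phi>] by simp_all
    \<comment> \<open>For these paths the two equations of \<open>inverse_cells\<close> are
      precisely (A) and (J).\<close>
    ultimately show ?case
      using inverse_cells_horizontal[OF P _ Q _ \<psi> \<phi>] by simp
  next
    case (2 A J \<chi>)
    then have J: "J \<in> hhom K A A" by simp
    then have A: "A \<in> objects K" using hpaths_objects edge_hpaths by blast
    note paths = edge_hpaths[OF J] empty_path_hpaths[OF A]
    \<comment> \<open>Both shapes of \<open>\<chi>\<close> are covered at once by taking
      \<open>P\<close> and \<open>Q\<close> to be its horizontal source and target. No partner cell
      has to be given, since either universal property produces an inverse.\<close>
    have ends: "hsource K \<chi> \<in> hpaths K A A" "htarget K \<chi> \<in> hpaths K A A"
      using 2 paths by auto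
    have lengths: "path_length (hsource K \<chi>) \<le> 1" "path_length (htarget K \<chi>) \<le> 1"
      using 2 by auto
    have "\<chi> \<in> horizontal_hom K A A (hsource K \<chi>) (htarget K \<chi>)"
      using horizontal_cellD 2 ends by blast
    then show ?case
      by (rule cartesian_iff_weakly_cocartesian[OF ends(1) lengths(1) ends(2) lengths(2)])
  qed
qed

end
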